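(* For every finite approximation set $A$ and $D=\mathrm{Dom}_r(A)$, $$\mathrm{TSM}_\rho(D;r)=I_{R_2}(A;r).$$ Moreover, if $\mathrm{Dom}_r(B)\subseteq\mathrm{Dom}_r(A)$ (with $B$ also a finite approximation set), then $$\mathrm{TSM}_\rho(\mathrm{Dom}_r(A);r)\ge\mathrm{TSM}_\rho(\mathrm{Dom}_r(B);r).$$
   Context: Minimization convention in $\mathbb{R}^m$; approximation sets are finite subsets of objective space $\mathbb{R}^m$. $r$ is a reference point and $z^+$ a utopian point. $\mathrm{Dom}_r(A)=\bigcup_{a\in A}[a_1,r_1]\times\cdots\times[a_m,r_m]$. $\Delta^{m-1}=\{\lambda\in\mathbb{R}_+^m:\sum_i\lambda_i=1\}$ with surface measure $\sigma$, and $\rho$ is a nonnegative weight density on $\Delta^{m-1}$. The weighted Tchebycheff scalarization is $g_\lambda(y;z^+)=\max_i\lambda_i(y_i-z_i^+)$; $h_A(\lambda)=\min_{a\in A}g_\lambda(a;z^+)$ and $h_r(\lambda)=g_\lambda(r;z^+)$. Exact integral $R_2$ improvement: $I_{R_2}(A;r)=\int_{\Delta^{m-1}}(h_r(\lambda)-h_A(\lambda))_+\,\rho(\lambda)\,d\sigma(\lambda)$, with $(u)_+=\max\{u,0\}$. For $D=\mathrm{Dom}_r(A)$ define $h_D(\lambda)=\inf_{y\in D}g_\lambda(y;z^+)=h_A(\lambda)$ and the one-dimensional shadow $\mathrm{Sh}_\lambda(D;r)=[h_D(\lambda),h_r(\lambda)]$, empty if the lower endpoint exceeds the upper endpoint.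 The Tchebycheff shadow magnitude is $\mathrm{TSM}_\rho(D;r)=\int_{\Delta^{m-1}}\mathcal{H}^1(\mathrm{Sh}_\lambda(D;r))\,\rho(\lambda)\,d\sigma(\lambda)$, where $\mathcal{H}^1$ is one-dimensional Hausdorff measure (length).
   Formalization: The equality is stated for finite A all of whose points satisfy a_i ≤ r_i for every i; otherwise a box can be empty and the equality fails, e.g. z^+=(-1,-1), r=(1,1), A={(0,10)}, ρ=1 gives TSM=0 but I_{R_2}>0. *)

theory Defs
  imports "HOL-Analysis.Analysis"
begin

section \<open>Hausdorff measure\<close>

text \<open>
  \<^term>\<open>diameter\<close> is only meaningful for bounded sets, hence the
  boundedness condition on covers. The empty set is treated separately since
  \<^prop>\<open>(0::real) ^ 0 = 1\<close>.
  The factor \<^term>\<open>unit_ball_vol (real k) / 2 ^ k\<close> is the standard normalisation,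
  under which the \<open>k\<close>-dimensional measure restricts to \<open>k\<close>-dimensional Lebesgue measure
  (length for \<open>k = 1\<close>, surface area in general) on \<open>k\<close>-dimensional affine subspaces.
\<close>

definition hausdorff_gauge :: "nat \<Rightarrow> 'a::metric_space set \<Rightarrow> ennreal" where
  "hausdorff_gauge k C =
     (if C = {} then 0 else ennreal (unit_ball_vol (real k) * (diameter C / 2) ^ k))"

definition hausdorff_covers :: "real \<Rightarrow> 'a::metric_space set \<Rightarrow> (nat \<Rightarrow> 'a set) set" where
  "hausdorff_covers \<delta> S =
     {C. (\<forall>i. bounded (C i) \<and> diameter (C i) \<le> \<delta>) \<and> S \<subseteq> (\<Union>i. C i)}"

definition hausdorff_premeasure :: "nat \<Rightarrow> real \<Rightarrow> 'a::metric_space set \<Rightarrow> ennreal" where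
  "hausdorff_premeasure k \<delta> S = (INF C\<in>hausdorff_covers \<delta> S. \<Sum>i. hausdorff_gauge k (C i))"

definition hausdorff_measure :: "nat \<Rightarrow> 'a::metric_space set \<Rightarrow> ennreal" where
  "hausdorff_measure k S = (SUP \<delta>\<in>{0<..}. hausdorff_premeasure k \<delta> S)"

definition hausdorff_borel :: "nat \<Rightarrow> 'a::metric_space measure" where
  "hausdorff_borel k = measure_of UNIV (sets borel) (hausdorff_measure k)"

text \<open>
  \<^const>\<open>measure_of\<close> yields the null measure when its argument is not countably additive.
  The following lemmas show that this does not happen here.
\<close>

lemma hausdorff_gauge_mono:
  assumes "C \<subseteq> D" "bounded D"
  shows "hausdorff_gauge k C \<le> hausdorff_gauge k D"
proof (cases "C = {}")
  case False
  have "bounded C" using assms bounded_subset by metis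
  then have "0 \<le> diameter C" by (rule diameter_ge_0)
  moreover have "diameter C \<le> diameter D" using assms by (rule diameter_subset)
  ultimately have "(diameter C / 2) ^ k \<le> (diameter D / 2) ^ k"
    by (intro power_mono) auto
  then have "ennreal (unit_ball_vol (real k) * (diameter C / 2) ^ k)
      \<le> ennreal (unit_ball_vol (real k) * (diameter D / 2) ^ k)"
    by (intro ennreal_leI mult_left_mono) simp_all
  moreover have "D \<noteq> {}" using False assms by blast
  ultimately show ?thesis using False by (simp add: hausdorff_gauge_def)
qed (simp add: hausdorff_gauge_def)

lemma hausdorff_premeasure_antimono:
  assumes "d \<le> e" shows "hausdorff_premeasure k e S \<le> hausdorff_premeasure k d S"
proof -
  have "hausdorff_covers d S \<subseteq> hausdorff_covers e S"
    unfolding hausdorff_covers_def using assms by (blast intro: order_trans)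
  then show ?thesis unfolding hausdorff_premeasure_def by (rule INF_superset_mono) simp
qed

lemma hausdorff_premeasure_mono:
  assumes "S \<subseteq> T" shows "hausdorff_premeasure k d S \<le> hausdorff_premeasure k d T"
proof -
  have "hausdorff_covers d T \<subseteq> hausdorff_covers d S"
    unfolding hausdorff_covers_def using assms by blast
  then show ?thesis unfolding hausdorff_premeasure_def by (rule INF_superset_mono) simp
qed

lemma hausdorff_premeasure_le:
  "d > 0 \<Longrightarrow> hausdorff_premeasure k d S \<le> hausdorff_measure k S"
  unfolding hausdorff_measure_def by (rule SUP_upper) simp

lemma hausdorff_premeasure_empty:
  assumes "d > 0" shows "hausdorff_premeasure k d ({} :: 'a::metric_space set) = 0"
proof -
  have "(\<lambda>_. {}) \<in> hausdorff_covers d ({} :: 'a set)"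
    using assms by (auto simp: hausdorff_covers_def)
  then have "hausdorff_premeasure k d ({} :: 'a set) \<le> (\<Sum>i::nat. hausdorff_gauge k ({}::'a set))"
    unfolding hausdorff_premeasure_def by (rule INF_lower)
  then show ?thesis by (simp add: hausdorff_gauge_def)
qed

lemma hausdorff_measure_empty [simp]: "hausdorff_measure k {} = 0"
  unfolding hausdorff_measure_def
  by (rule SUP_eq_const) (auto simp: hausdorff_premeasure_empty)

lemma hausdorff_measure_mono: "S \<subseteq> T \<Longrightarrow> hausdorff_measure k S \<le> hausdorff_measure k T"
  unfolding hausdorff_measure_def by (rule SUP_subset_mono) (simp_all add: hausdorff_premeasure_mono)

lemma hausdorff_premeasure_subadditive:
  assumes "d > 0"
  shows "hausdorff_premeasure k d (\<Union>n. A n) \<le> (\<Sum>n. hausdorff_premeasure k d (A n))"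
proof (cases "\<exists>n. hausdorff_premeasure k d (A n) = \<infinity>")
  case True
  then obtain n where "hausdorff_premeasure k d (A n) = \<infinity>" by blast
  moreover have "hausdorff_premeasure k d (A n) \<le> (\<Sum>n. hausdorff_premeasure k d (A n))"
    using sum_le_suminf[of "\<lambda>n. hausdorff_premeasure k d (A n)" "{n}"] by simp
  ultimately show ?thesis by (simp add: top_unique)
next
  case False
  show ?thesis
  proof (rule ennreal_le_epsilon)
    fix e :: real assume e: "0 < e"
    have "\<exists>C\<in>hausdorff_covers d (A n). (\<Sum>i. hausdorff_gauge k (C i))
            \<le> hausdorff_premeasure k d (A n) + ennreal (e * (1/2)^Suc n)" for n
    proof (rule ccontr)
      assume "\<not> ?thesis"
      then have "hausdorff_premeasure k d (A n) + ennreal (e * (1/2)^Suc n)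
          \<le> hausdorff_premeasure k d (A n)"
        by (subst (2) hausdorff_premeasure_def) (force intro!: INF_greatest)
      moreover have "hausdorff_premeasure k d (A n) < \<infinity>"
        using False by (simp add: less_top)
      moreover have "0 < e * (1/2)^Suc n" using e by simp
      ultimately show False
        by (cases "hausdorff_premeasure k d (A n)")
          (auto simp del: power_Suc simp flip: ennreal_plus)
    qed
    then obtain C where C: "\<And>n. C n \<in> hausdorff_covers d (A n)"
      and Cs: "\<And>n. (\<Sum>i. hausdorff_gauge k (C n i))
            \<le> hausdorff_premeasure k d (A n) + ennreal (e * (1/2)^Suc n)"
      by metis
    define D where "D = (\<lambda>m. case prod_decode m of (n, i) \<Rightarrow> C n i)"
    have "D \<in> hausdorff_covers d (\<Union>n. A n)"
    proof -
      have "x \<in> (\<Union>m. D m)" if x: "x \<in> A n" for x n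
      proof -
        obtain i where "x \<in> C n i" using C[of n] x unfolding hausdorff_covers_def by blast
        then have "x \<in> D (prod_encode (n, i))" by (simp add: D_def)
        then show ?thesis by blast
      qed
      then show ?thesis using C by (auto simp: hausdorff_covers_def D_def split: prod.split)
    qed
    then have "hausdorff_premeasure k d (\<Union>n. A n) \<le> (\<Sum>m. hausdorff_gauge k (D m))"
      unfolding hausdorff_premeasure_def by (rule INF_lower)
    also have "\<dots> = (\<Sum>n. \<Sum>i. hausdorff_gauge k (C n i))"
      using suminf_ennreal_2dimen[of "\<lambda>n. \<Sum>i. hausdorff_gauge k (C n i)"
          "\<lambda>(n, i). hausdorff_gauge k (C n i)"]
      by (simp add: D_def comp_def case_prod_unfold)
    also have "\<dots> \<le> (\<Sum>n. hausdorff_premeasure k d (A n) + ennreal (e * (1/2)^Suc n))"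
      by (intro suminf_le Cs) auto
    also have "\<dots> = (\<Sum>n. hausdorff_premeasure k d (A n)) + (\<Sum>n. ennreal (e * (1/2)^Suc n))"
      by (rule suminf_add[symmetric]) auto
    also have "(\<Sum>n. ennreal (e * (1/2)^Suc n)) = ennreal e"
      using e sums_mult[OF power_half_series, of e]
      by (intro suminf_ennreal_eq) auto
    finally show "hausdorff_premeasure k d (\<Union>n. A n)
        \<le> (\<Sum>n. hausdorff_premeasure k d (A n)) + ennreal e" .
  qed
qed

lemma outer_measure_space_hausdorff:
  "outer_measure_space UNIV (hausdorff_measure k :: 'a::metric_space set \<Rightarrow> ennreal)"
  unfolding outer_measure_space_def
proof (intro conjI)
  show "positive UNIV (hausdorff_measure k :: 'a set \<Rightarrow> ennreal)" by (simp add: positive_def)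
  show "increasing UNIV (hausdorff_measure k :: 'a set \<Rightarrow> ennreal)"
    by (simp add: increasing_def hausdorff_measure_mono)
  have "hausdorff_measure k (\<Union>n. A n) \<le> (\<Sum>n. hausdorff_measure k (A n))"
    for A :: "nat \<Rightarrow> 'a set"
  proof (subst hausdorff_measure_def, rule SUP_least)
    fix d :: real assume d: "d \<in> {0<..}"
    have "hausdorff_premeasure k d (\<Union>n. A n) \<le> (\<Sum>n. hausdorff_premeasure k d (A n))"
      using d by (intro hausdorff_premeasure_subadditive) auto
    also have "\<dots> \<le> (\<Sum>n. hausdorff_measure k (A n))"
      using d by (intro suminf_le hausdorff_premeasure_le) auto
    finally show "hausdorff_premeasure k d (\<Union>n. A n) \<le> (\<Sum>n. hausdorff_measure k (A n))" .
  qed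
  then show "countably_subadditive UNIV (hausdorff_measure k :: 'a set \<Rightarrow> ennreal)"
    by (auto simp: countably_subadditive_def)
qed

lemma hausdorff_measure_separated:
  assumes d: "0 < d" and sep: "\<And>x y. x \<in> A \<Longrightarrow> y \<in> B \<Longrightarrow> d \<le> dist x y"
  shows "hausdorff_measure k A + hausdorff_measure k B \<le> hausdorff_measure k (A \<union> B)"
proof -
  have small: "hausdorff_premeasure k e A + hausdorff_premeasure k e B
      \<le> hausdorff_premeasure k e (A \<union> B)" if e: "0 < e" "e < d" for e
    unfolding hausdorff_premeasure_def[of k e "A \<union> B"]
  proof (rule INF_greatest)
    fix C assume C: "C \<in> hausdorff_covers e (A \<union> B)"
    then have b: "bounded (C i)" and di: "diameter (C i) \<le> e" for i
      by (auto simp: hausdorff_covers_def)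
    have sub: "(\<lambda>i. C i \<inter> S) \<in> hausdorff_covers e S" if "S \<subseteq> A \<union> B" for S
    proof -
      have "bounded (C i \<inter> S)" "diameter (C i \<inter> S) \<le> e" for i
        using bounded_subset[OF b[of i], of "C i \<inter> S"]
          diameter_subset[OF _ b[of i], of "C i \<inter> S"] di[of i] by auto
      then show ?thesis using that C by (fastforce simp: hausdorff_covers_def)
    qed
    have one: "hausdorff_gauge k (C i \<inter> A) + hausdorff_gauge k (C i \<inter> B)
        \<le> hausdorff_gauge k (C i)" for i
    proof -
      have "C i \<inter> A = {} \<or> C i \<inter> B = {}"
      proof (rule ccontr)
        assume "\<not> ?thesis"
        then obtain x y where xy: "x \<in> C i" "x \<in> A" "y \<in> C i" "y \<in> B" by blast
        then have "d \<le> dist x y" "dist x y \<le> e"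
          using sep diameter_bounded_bound[OF b[of i], of x y] di[of i] by auto
        then show False using e by simp
      qed
      then show ?thesis
        using hausdorff_gauge_mono[OF _ b, of "C i \<inter> A" i k]
          hausdorff_gauge_mono[OF _ b, of "C i \<inter> B" i k]
        by (auto simp: hausdorff_gauge_def[of k "{}"])
    qed
    have "hausdorff_premeasure k e A + hausdorff_premeasure k e B
        \<le> (\<Sum>i. hausdorff_gauge k (C i \<inter> A)) + (\<Sum>i. hausdorff_gauge k (C i \<inter> B))"
      unfolding hausdorff_premeasure_def
      by (intro add_mono INF_lower sub) auto
    also have "\<dots> = (\<Sum>i. hausdorff_gauge k (C i \<inter> A) + hausdorff_gauge k (C i \<inter> B))"
      by (rule suminf_add) auto
    also have "\<dots> \<le> (\<Sum>i. hausdorff_gauge k (C i))"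
      by (intro suminf_le one) auto
    finally show "hausdorff_premeasure k e A + hausdorff_premeasure k e B
        \<le> (\<Sum>i. hausdorff_gauge k (C i))" .
  qed
  have all: "hausdorff_premeasure k e1 A + hausdorff_premeasure k e2 B
      \<le> hausdorff_measure k (A \<union> B)" if "0 < e1" "0 < e2" for e1 e2
  proof -
    define e where "e = min (min e1 e2) (d / 2)"
    have e: "0 < e" "e < d" "e \<le> e1" "e \<le> e2" using that d by (auto simp: e_def)
    have "hausdorff_premeasure k e1 A + hausdorff_premeasure k e2 B
        \<le> hausdorff_premeasure k e A + hausdorff_premeasure k e B"
      by (intro add_mono hausdorff_premeasure_antimono e)
    also have "\<dots> \<le> hausdorff_premeasure k e (A \<union> B)" by (intro small e)
    also have "\<dots> \<le> hausdorff_measure k (A \<union> B)" by (intro hausdorff_premeasure_le e)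
    finally show ?thesis .
  qed
  have "hausdorff_premeasure k e1 A + hausdorff_measure k B \<le> hausdorff_measure k (A \<union> B)"
    if "0 < e1" for e1
  proof -
    have "hausdorff_premeasure k e1 A + hausdorff_measure k B
        = (SUP e2\<in>{0<..}. hausdorff_premeasure k e1 A + hausdorff_premeasure k e2 B)"
      unfolding hausdorff_measure_def by (rule ennreal_SUP_add_right) auto
    then show ?thesis using that all by (auto intro!: SUP_least)
  qed
  moreover have "hausdorff_measure k A + hausdorff_measure k B
      = (SUP e1\<in>{0<..}. hausdorff_premeasure k e1 A + hausdorff_measure k B)"
    unfolding hausdorff_measure_def[of k A] by (rule ennreal_SUP_add_left[symmetric]) auto
  ultimately show ?thesis by (auto intro!: SUP_least)
qed

text \<open>Caratheodory's criterion for metric outer measures.\<close>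

lemma closed_in_lambda_system:
  fixes f :: "'a::metric_space set \<Rightarrow> ennreal"
  assumes oms: "outer_measure_space UNIV f"
    and met: "\<And>A B d. 0 < d \<Longrightarrow> (\<And>x y. x \<in> A \<Longrightarrow> y \<in> B \<Longrightarrow> d \<le> dist x y)
      \<Longrightarrow> f A + f B \<le> f (A \<union> B)"
    and F: "closed F"
  shows "F \<in> lambda_system UNIV UNIV f"
proof -
  have f0: "f {} = 0" and mono: "A \<subseteq> B \<Longrightarrow> f A \<le> f B" for A B
    using oms by (auto simp: outer_measure_space_def positive_def increasing_def)
  have csub: "f (\<Union>i. A i) \<le> (\<Sum>i. f (A i))" for A :: "nat \<Rightarrow> 'a set"
  proof -
    have "f (\<Union>i. disjointed A i) \<le> (\<Sum>i. f (disjointed A i))"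
      using oms disjoint_family_disjointed[of A]
      by (simp add: outer_measure_space_def countably_subadditive_def)
    also have "\<dots> \<le> (\<Sum>i. f (A i))"
      by (intro suminf_le mono disjointed_subset) auto
    finally show ?thesis by (simp add: UN_disjointed_eq)
  qed
  have sub: "f (A \<union> B) \<le> f A + f B" for A B
  proof -
    have "f (\<Union>i. binaryset A B i) \<le> (\<Sum>i. f (binaryset A B i))" by (rule csub)
    then show ?thesis by (simp add: UN_binaryset_eq suminf_binaryset_eq f0)
  qed
  have "f (F \<inter> X) + f (X - F) \<le> f X" for X
  proof (cases "F = {} \<or> f X = \<infinity>")
    case True then show ?thesis by (auto simp: f0)
  next
    case False
    then have Fne: "F \<noteq> {}" and fin: "f X < \<infinity>" by (auto simp: less_top)
    define c where "c n = inverse (real (Suc n))" for n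
    have c_less: "c (Suc n) < c n" and c_pos: "c n > 0" for n
      by (auto simp: c_def field_simps)
    define Y where "Y n = {x \<in> X. c n \<le> infdist x F}" for n
    define R where "R n = Y (Suc n) - Y n" for n
    have Y_mono: "Y m \<subseteq> Y n" if "m \<le> n" for m n
    proof -
      have "c n \<le> c m" using that by (simp add: c_def le_imp_inverse_le)
      then show ?thesis by (auto simp: Y_def)
    qed
    have sep: "c n - c (Suc n) \<le> dist x y" if "x \<in> Y n" "y \<in> X - Y (Suc n)" for n x y
      using that infdist_triangle[of x F y] by (auto simp: Y_def dist_commute)
    have partial: "(\<Sum>i<N. f (R (2*i+p))) \<le> f (\<Union>i<N. R (2*i+p))" for N p
    proof (induction N)
      case (Suc N)
      show ?case
      proof (cases N)
        case 0 then show ?thesis by (simp add: lessThan_Suc)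
      next
        case N: (Suc M)
        have "(\<Union>i<N. R (2*i+p)) \<subseteq> Y (2*M+p+1)"
        proof (rule UN_least)
          fix i assume "i \<in> {..<N}"
          then have "Y (Suc (2*i+p)) \<subseteq> Y (2*M+p+1)" by (intro Y_mono) (simp add: N)
          then show "R (2*i+p) \<subseteq> Y (2*M+p+1)" by (auto simp: R_def)
        qed
        moreover have "R (2*N+p) \<subseteq> X - Y (Suc (2*M+p+1))"
          by (auto simp: R_def N Y_def)
        ultimately have A: "f (\<Union>i<N. R (2*i+p)) + f (R (2*N+p))
            \<le> f ((\<Union>i<N. R (2*i+p)) \<union> R (2*N+p))"
          using c_less[of "2*M+p+1"]
          by (intro met[of "c (2*M+p+1) - c (Suc (2*M+p+1))"] sep) auto
        have B: "(\<Union>i<N. R (2*i+p)) \<union> R (2*N+p) = (\<Union>i<Suc N. R (2*i+p))"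
          unfolding lessThan_Suc by blast
        have "(\<Sum>i<Suc N. f (R (2*i+p))) \<le> f (\<Union>i<N. R (2*i+p)) + f (R (2*N+p))"
          unfolding sum.lessThan_Suc by (intro add_right_mono Suc.IH)
        also have "\<dots> \<le> f (\<Union>i<Suc N. R (2*i+p))" using A unfolding B .
        finally show ?thesis .
      qed
    qed (simp add: f0)
    have partialX: "(\<Sum>i<N. f (R (2*i+p))) \<le> f X" for N p
      by (rule order_trans[OF partial mono]) (auto simp: R_def Y_def)
    have halves: "(\<Sum>i<2*N. f (R i)) = (\<Sum>i<N. f (R (2*i+0))) + (\<Sum>i<N. f (R (2*i+1)))" for N
      by (induction N) (auto simp: algebra_simps)
    have two: "(\<Sum>i<2*N. f (R i)) \<le> f X + f X" for N
      unfolding halves by (intro add_mono partialX)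
    have "(\<Sum>i. f (R i)) \<le> f X + f X"
    proof (rule suminf_le_const)
      fix n have "(\<Sum>i<n. f (R i)) \<le> (\<Sum>i<2*n. f (R i))"
        by (intro sum_mono2) auto
      also have "\<dots> \<le> f X + f X" by (rule two)
      finally show "(\<Sum>i<n. f (R i)) \<le> f X + f X" .
    qed auto
    also have "f X + f X < \<infinity>" using fin by simp
    finally have Rfin: "(\<Sum>i. f (R i)) < \<infinity>" .
    define r where "r i = enn2real (f (R i))" for i
    have fr: "f (R i) = ennreal (r i)" for i
    proof -
      have "f (R i) \<le> f X" by (rule mono) (auto simp: R_def Y_def)
      then have "f (R i) < top" using fin by (auto intro: le_less_trans)
      then show ?thesis by (simp add: r_def)
    qed
    have r0: "0 \<le> r i" for i by (simp add: r_def)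
    have sr: "summable r"
      using Rfin r0 by (intro summable_suminf_not_top) (auto simp: fr less_top)
    show ?thesis
    proof (rule ennreal_le_epsilon)
      fix e :: real assume e: "0 < e"
      obtain n where n: "norm (\<Sum>i. r (i + n)) < e"
        using suminf_exist_split[OF e sr] by blast
      have tail: "(\<Sum>i. f (R (i + n))) \<le> ennreal e"
      proof -
        have "(\<Sum>i. f (R (i + n))) = ennreal (\<Sum>i. r (i + n))"
          unfolding fr using sr r0 by (intro suminf_ennreal2) auto
        then show ?thesis using n by (simp add: ennreal_leI)
      qed
      have "X - F \<subseteq> Y n \<union> (\<Union>i. R (i + n))"
      proof
        fix x assume x: "x \<in> X - F"
        then have "0 < infdist x F"
          using F Fne in_closed_iff_infdist_zero[of F x] infdist_nonneg[of x F] by force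
        then obtain m where "c m < infdist x F"
          unfolding c_def using reals_Archimedean by blast
        then have xm: "x \<in> Y m" using x by (auto simp: Y_def)
        define l where "l = (LEAST m. x \<in> Y m)"
        have xl: "x \<in> Y l" using xm unfolding l_def by (rule LeastI)
        show "x \<in> Y n \<union> (\<Union>i. R (i + n))"
        proof (cases "l \<le> n")
          case True then show ?thesis using xl Y_mono[OF True] by blast
        next
          case False
          define j where "j = l - Suc n"
          have j: "l = Suc (j + n)" using False by (simp add: j_def)
          have "x \<notin> Y (j + n)" using not_less_Least[of "j + n" "\<lambda>m. x \<in> Y m"] j
            unfolding l_def[symmetric] by simp
          then have "x \<in> R (j + n)" using xl unfolding j R_def by blast
          then show ?thesis by blast
        qed
      qed
      then have "f (X - F) \<le> f (Y n \<union> (\<Union>i. R (i + n)))" by (rule mono)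
      also have "\<dots> \<le> f (Y n) + f (\<Union>i. R (i + n))" by (rule sub)
      also have "\<dots> \<le> f (Y n) + ennreal e"
        by (intro add_mono order_refl order_trans[OF csub tail])
      finally have 1: "f (X - F) \<le> f (Y n) + ennreal e" .
      have "f (F \<inter> X) + f (Y n) \<le> f (F \<inter> X \<union> Y n)"
      proof (rule met[OF c_pos[of n]])
        fix x y assume "x \<in> F \<inter> X" "y \<in> Y n"
        then show "c n \<le> dist x y"
          using infdist_le[of x F y] by (auto simp: Y_def dist_commute)
      qed
      also have "\<dots> \<le> f X" by (rule mono) (auto simp: Y_def)
      finally have 2: "f (F \<inter> X) + f (Y n) \<le> f X" .
      have "f (F \<inter> X) + f (X - F) \<le> f (F \<inter> X) + f (Y n) + ennreal e"
        using add_left_mono[OF 1] by (simp add: add.assoc)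
      also have "\<dots> \<le> f X + ennreal e" using 2 by (rule add_right_mono)
      finally show "f (F \<inter> X) + f (X - F) \<le> f X + ennreal e" .
    qed
  qed
  moreover have "f X \<le> f (F \<inter> X) + f (X - F)" for X
  proof -
    have "F \<inter> X \<union> (X - F) = X" by blast
    then show ?thesis using sub[of "F \<inter> X" "X - F"] by simp
  qed
  ultimately have eq: "f (F \<inter> X) + f (X - F) = f X" for X
    by (intro antisym)
  have "(UNIV - F) \<inter> X = X - F" for X by blast
  then show ?thesis unfolding lambda_system_def using eq by simp
qed

lemma measure_space_hausdorff:
  "measure_space UNIV (sets (borel :: 'a::metric_space measure)) (hausdorff_measure k)"
proof -
  interpret sigma_algebra UNIV "UNIV :: 'a set set" using sigma_algebra_Pow[of "UNIV::'a set"] by simp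
  let ?L = "lambda_system UNIV UNIV (hausdorff_measure k :: 'a set \<Rightarrow> ennreal)"
  have ms: "measure_space UNIV ?L (hausdorff_measure k)"
    by (rule caratheodory_lemma[OF outer_measure_space_hausdorff])
  then have sa: "sigma_algebra UNIV ?L" by (simp add: measure_space_def)
  have "sets (borel :: 'a measure) = sigma_sets UNIV (Collect closed)"
    by (simp add: borel_eq_closed)
  also have "\<dots> \<subseteq> ?L"
  proof (rule sigma_algebra.sigma_sets_subset[OF sa], rule subsetI)
    fix F :: "'a set" assume "F \<in> Collect closed"
    then have F: "closed F" by simp
    show "F \<in> ?L"
    proof (rule closed_in_lambda_system[OF outer_measure_space_hausdorff _ F])
      fix A B :: "'a set" and d :: real
      assume d: "0 < d" and sep: "\<And>x y. x \<in> A \<Longrightarrow> y \<in> B \<Longrightarrow> d \<le> dist x y"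
      show "hausdorff_measure k A + hausdorff_measure k B \<le> hausdorff_measure k (A \<union> B)"
        using hausdorff_measure_separated[of d A B k, OF d sep] by blast
    qed
  qed
  finally show ?thesis
    using measure_down[OF ms] sets.sigma_algebra_axioms[of "borel :: 'a measure"] by simp
qed

lemma sets_hausdorff_borel [measurable_cong, simp]: "sets (hausdorff_borel k) = sets borel"
  using sets.sigma_sets_eq[of borel] by (simp add: hausdorff_borel_def)

lemma space_hausdorff_borel [simp]: "space (hausdorff_borel k) = UNIV"
  by (simp add: hausdorff_borel_def)

lemma emeasure_hausdorff_borel:
  fixes S :: "'a::metric_space set"
  assumes "S \<in> sets borel" shows "emeasure (hausdorff_borel k) S = hausdorff_measure k S"
proof -
  have "sigma_algebra UNIV (sets (borel :: 'a measure))"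
    using sets.sigma_algebra_axioms[of "borel :: 'a measure"] by simp
  then show ?thesis
    using assms measure_space_hausdorff[of k, where 'a='a] unfolding hausdorff_borel_def
    by (intro emeasure_measure_of_sigma) (auto simp: measure_space_def)
qed


section \<open>Tchebycheff shadows and the integral R2 indicator\<close>

definition weight_simplex :: "(real ^ 'm) set" where
  "weight_simplex = {w. (\<forall>i. 0 \<le> w $ i) \<and> (\<Sum>i\<in>UNIV. w $ i) = 1}"

definition simplex_surface :: "(real ^ 'm) measure" where
  "simplex_surface = restrict_space (hausdorff_borel (CARD('m) - 1)) weight_simplex"

definition Dom :: "real ^ 'm \<Rightarrow> (real ^ 'm) set \<Rightarrow> (real ^ 'm) set" where
  "Dom r A = (\<Union>a\<in>A. cbox a r)"

definition tcheb :: "real ^ 'm \<Rightarrow> real ^ 'm \<Rightarrow> real ^ 'm \<Rightarrow> real" where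
  "tcheb z w y = (MAX i. w $ i * (y $ i - z $ i))"

text \<open>
  Values are extended reals so that the empty set gets the value \<open>\<infinity>\<close>, both for the
  minimum over a finite set and for the infimum over a dominated region.
\<close>

definition min_tcheb :: "real ^ 'm \<Rightarrow> (real ^ 'm) set \<Rightarrow> real ^ 'm \<Rightarrow> ereal" where
  "min_tcheb z A w = (if A = {} then \<infinity> else ereal (MIN a\<in>A. tcheb z w a))"

definition inf_tcheb :: "real ^ 'm \<Rightarrow> (real ^ 'm) set \<Rightarrow> real ^ 'm \<Rightarrow> ereal" where
  "inf_tcheb z D w = (INF y\<in>D. ereal (tcheb z w y))"

definition R2_improvement ::
    "(real ^ 'm \<Rightarrow> real) \<Rightarrow> real ^ 'm \<Rightarrow> real ^ 'm \<Rightarrow> (real ^ 'm) set \<Rightarrow> ennreal" where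
  "R2_improvement \<rho> z r A =
     (\<integral>\<^sup>+ w. e2ennreal (max 0 (ereal (tcheb z w r) - min_tcheb z A w)) * ennreal (\<rho> w)
        \<partial>simplex_surface)"

definition shadow :: "real ^ 'm \<Rightarrow> real ^ 'm \<Rightarrow> (real ^ 'm) set \<Rightarrow> real ^ 'm \<Rightarrow> real set" where
  "shadow z r D w = {t. inf_tcheb z D w \<le> ereal t \<and> t \<le> tcheb z w r}"

definition TSM ::
    "(real ^ 'm \<Rightarrow> real) \<Rightarrow> real ^ 'm \<Rightarrow> real ^ 'm \<Rightarrow> (real ^ 'm) set \<Rightarrow> ennreal" where
  "TSM \<rho> z r D =
     (\<integral>\<^sup>+ w. hausdorff_measure 1 (shadow z r D w) * ennreal (\<rho> w) \<partial>simplex_surface)"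

end

theory Submission
  imports Defs
begin

text \<open>
  Both indicators integrate a nonnegative function of the weight against the same density, so
  it suffices to compare integrands at a single weight. For a nonnegative weight \<open>w\<close> the
  scalarization \<^term>\<open>tcheb z w\<close> is monotone in the objective vector, hence on each box
  \<^term>\<open>cbox a r\<close> it is minimized at the lower corner \<open>a\<close>. Thus the infimum over the dominated
  region equals the minimum over the approximation set
  (\<open>inf_tcheb_Dom\<close>), and the shadow is the interval from that minimum to the value at the
  reference point. What remains is that one-dimensional Hausdorff measure assigns to an interval
  its length (\<open>hausdorff_measure_1_atLeastAtMost\<close>): subdivision into short pieces bounds it from
  above, and comparison with Lebesgue measure bounds it from below, because a bounded subset of the line
  lies in an interval as long as its diameter.

  The inequality for nested dominated regions involves no computation: a larger region
  has a smaller infimum and so a larger shadow, and Hausdorff measure is monotone.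
\<close>

section \<open>One-dimensional Hausdorff measure of an interval\<close>

lemma hausdorff_gauge_1:
  "hausdorff_gauge 1 C = (if C = {} then 0 else ennreal (diameter C))"
  by (simp add: hausdorff_gauge_def unit_ball_vol_1)

lemma bounded_real_subset_interval_diameter:
  fixes C :: "real set"
  assumes "bounded C" "C \<noteq> {}"
  shows "\<exists>c. C \<subseteq> {c..c + diameter C}"
proof -
  have "y \<le> x + diameter C" if "x \<in> C" "y \<in> C" for x y
    using diameter_bounded_bound[OF assms(1) that] by (simp add: dist_real_def)
  then have "y - diameter C \<le> Inf C" if "y \<in> C" for y
    using that assms(2) by (intro cInf_greatest) (auto simp: algebra_simps)
  moreover have "Inf C \<le> y" if "y \<in> C" for y
    using that assms(1) by (intro cInf_lower bounded_imp_bdd_below)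
  ultimately show ?thesis
    by (intro exI[of _ "Inf C"]) (auto simp: algebra_simps)
qed

text \<open>
  Every cover by bounded sets can be enlarged to one by intervals of total length the sum of the
  diameters, so countable subadditivity of Lebesgue measure already gives the bound at any
  scale \<open>d\<close>.
\<close>

lemma hausdorff_premeasure_1_ge_lborel:
  fixes S :: "real set"
  assumes "S \<in> sets borel"
  shows "emeasure lborel S \<le> hausdorff_premeasure 1 d S"
  unfolding hausdorff_premeasure_def
proof (rule INF_greatest)
  fix C assume "C \<in> hausdorff_covers d S"
  then have b: "\<And>i. bounded (C i)" and S: "S \<subseteq> (\<Union>i. C i)"
    by (auto simp: hausdorff_covers_def)
  have "\<exists>J\<in>sets lborel. C i \<subseteq> J \<and> emeasure lborel J \<le> hausdorff_gauge 1 (C i)" for i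
  proof (cases "C i = {}")
    case False
    then obtain c where "C i \<subseteq> {c..c + diameter (C i)}"
      using bounded_real_subset_interval_diameter[OF b] by blast
    then show ?thesis
      using False diameter_ge_0[OF b, of i]
      by (intro bexI[of _ "{c..c + diameter (C i)}"])
        (auto simp: hausdorff_gauge_1 simp del: One_nat_def)
  qed (auto intro!: bexI[of _ "{}"])
  then obtain J where J: "\<And>i. J i \<in> sets lborel" "\<And>i. C i \<subseteq> J i"
    "\<And>i. emeasure lborel (J i) \<le> hausdorff_gauge 1 (C i)"
    by metis
  have "emeasure lborel S \<le> emeasure lborel (\<Union>i. J i)"
    using S J(1,2) by (intro emeasure_mono) (blast | auto)+
  also have "\<dots> \<le> (\<Sum>i. emeasure lborel (J i))"
    using J(1) by (intro emeasure_subadditive_countably) auto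
  also have "\<dots> \<le> (\<Sum>i. hausdorff_gauge 1 (C i))"
    by (intro suminf_le J(3)) auto
  finally show "emeasure lborel S \<le> (\<Sum>i. hausdorff_gauge 1 (C i))" .
qed

text \<open>
  Subdividing into equal pieces does not change the total length, whatever the
  prescribed mesh \<open>d\<close>.
\<close>

lemma hausdorff_premeasure_1_atLeastAtMost_le:
  fixes a b :: real
  assumes "a \<le> b" "0 < d"
  shows "hausdorff_premeasure 1 d {a..b} \<le> ennreal (b - a)"
proof -
  obtain n :: nat where n: "(b - a) / d < real n"
    using reals_Archimedean2 by blast
  have n0: "0 < real n"
    using n assms by (smt (verit) divide_nonneg_pos)
  define e where "e = (b - a) / real n"
  have e: "0 \<le> e" "e \<le> d" "real n * e = b - a"
    using n n0 assms by (auto simp: e_def field_simps)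
  define C where "C i = (if i < n then {a + real i * e..a + real (Suc i) * e} else {})" for i
  have step: "a + real i * e \<le> a + real (Suc i) * e" for i
    using e(1) by (simp add: algebra_simps)
  have dia: "diameter (C i) = e" if "i < n" for i
    using that step[of i] diameter_cbox[of "a + real i * e" "a + real (Suc i) * e"] e(1)
    by (simp add: C_def dist_real_def algebra_simps)
  have cover: "{a..a + real m * e} \<subseteq> (\<Union>i<m. {a + real i * e..a + real (Suc i) * e})"
    if "0 < m" for m
    using that
  proof (induction m rule: nat_induct_non_zero)
    case (Suc m)
    have "{a..a + real (Suc m) * e} \<subseteq> {a..a + real m * e} \<union> {a + real m * e..a + real (Suc m) * e}"
      by auto
    then show ?case
      using Suc.IH unfolding lessThan_Suc by blast
  qed auto
  have "{a..b} \<subseteq> (\<Union>i. C i)"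
    using cover[of n] n0 e(3) by (fastforce simp: C_def)
  moreover have "bounded (C i) \<and> diameter (C i) \<le> d" for i
    using dia[of i] e(2) assms(2) by (cases "i < n") (auto simp: C_def)
  ultimately have "C \<in> hausdorff_covers d {a..b}"
    by (auto simp: hausdorff_covers_def)
  then have "hausdorff_premeasure 1 d {a..b} \<le> (\<Sum>i. hausdorff_gauge 1 (C i))"
    unfolding hausdorff_premeasure_def by (rule INF_lower)
  also have "\<dots> = (\<Sum>i<n. hausdorff_gauge 1 (C i))"
    by (rule suminf_finite) (auto simp: C_def hausdorff_gauge_def)
  also have "\<dots> = (\<Sum>i<n. ennreal e)"
  proof (rule sum.cong[OF refl])
    fix i assume "i \<in> {..<n}"
    then show "hausdorff_gauge 1 (C i) = ennreal e"
      using dia[of i] step[of i] unfolding hausdorff_gauge_1 by (auto simp: C_def)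
  qed
  also have "\<dots> = ennreal (b - a)"
    using e(1) by (simp add: ennreal_of_nat_eq_real_of_nat ennreal_mult[symmetric] e(3))
  finally show ?thesis .
qed

lemma hausdorff_measure_1_atLeastAtMost:
  fixes a b :: real
  shows "hausdorff_measure 1 {a..b} = ennreal (b - a)"
proof (cases "a \<le> b")
  case True
  have "hausdorff_premeasure 1 d {a..b} = ennreal (b - a)" if "0 < d" for d
    using hausdorff_premeasure_1_atLeastAtMost_le[OF True that]
      hausdorff_premeasure_1_ge_lborel[of "{a..b}" d] True by (simp add: antisym)
  then show ?thesis
    unfolding hausdorff_measure_def by (intro SUP_eq_const) auto
qed (simp add: ennreal_neg)

section \<open>Scalarization over a dominated region\<close>

lemma tcheb_mono:
  fixes z w x y :: "real ^ 'm"
  assumes "\<And>i. 0 \<le> w $ i" "\<And>i. x $ i \<le> y $ i"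
  shows "tcheb z w x \<le> tcheb z w y"
proof -
  have "w $ i * (x $ i - z $ i) \<le> w $ i * (y $ i - z $ i)" for i
    using assms by (intro mult_left_mono) auto
  then show ?thesis
    unfolding tcheb_def
    by (intro Max.boundedI) (auto intro!: order_trans[OF _ Max_ge[OF _ rangeI]])
qed

lemma min_tcheb_eq_INF:
  assumes "finite A"
  shows "min_tcheb z A w = (INF a\<in>A. ereal (tcheb z w a))"
proof (cases "A = {}")
  case False
  show ?thesis
  proof (rule antisym)
    show "min_tcheb z A w \<le> (INF a\<in>A. ereal (tcheb z w a))"
      using assms False by (auto simp: min_tcheb_def intro!: INF_greatest Min_le)
    have "(MIN a\<in>A. tcheb z w a) \<in> tcheb z w ` A"
      using assms False by (intro Min_in) auto
    then obtain a where "a \<in> A" "(MIN a\<in>A. tcheb z w a) = tcheb z w a"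
      by auto
    then show "(INF a\<in>A. ereal (tcheb z w a)) \<le> min_tcheb z A w"
      using INF_lower[of a A "\<lambda>a. ereal (tcheb z w a)"] by (auto simp: min_tcheb_def)
  qed
qed (simp add: min_tcheb_def top_ereal_def)

text \<open>
  A point with some coordinate above \<open>r\<close> spans an empty box and drops out of the dominated
  region while still counting in the minimum over \<open>A\<close>; hence the bound on the points of \<open>A\<close>.
\<close>

lemma inf_tcheb_Dom:
  fixes r z w :: "real ^ 'm"
  assumes "finite A" and "\<And>a i. a \<in> A \<Longrightarrow> a $ i \<le> r $ i" and "\<And>i. 0 \<le> w $ i"
  shows "inf_tcheb z (Dom r A) w = min_tcheb z A w"
  unfolding min_tcheb_eq_INF[OF assms(1)] inf_tcheb_def
proof (rule antisym)
  have "A \<subseteq> Dom r A"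
    using assms(2) by (force simp: Dom_def mem_box_cart)
  then show "(INF y\<in>Dom r A. ereal (tcheb z w y)) \<le> (INF a\<in>A. ereal (tcheb z w a))"
    by (rule INF_superset_mono) simp
  show "(INF a\<in>A. ereal (tcheb z w a)) \<le> (INF y\<in>Dom r A. ereal (tcheb z w y))"
  proof (rule INF_greatest)
    fix y assume "y \<in> Dom r A"
    then obtain a where a: "a \<in> A" "\<And>i. a $ i \<le> y $ i"
      by (auto simp: Dom_def mem_box_cart)
    then have "ereal (tcheb z w a) \<le> ereal (tcheb z w y)"
      using assms(3) by (simp add: tcheb_mono)
    then show "(INF a\<in>A. ereal (tcheb z w a)) \<le> ereal (tcheb z w y)"
      by (rule INF_lower2[OF a(1)])
  qed
qed

section \<open>Shadows\<close>

text \<open>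
  The positive part in the integral improvement matches the convention that a shadow with
  reversed endpoints is empty.
\<close>

lemma hausdorff_measure_shadow_Dom:
  fixes r z w :: "real ^ 'm"
  assumes "finite A" and "\<And>a i. a \<in> A \<Longrightarrow> a $ i \<le> r $ i" and "\<And>i. 0 \<le> w $ i"
  shows "hausdorff_measure 1 (shadow z r (Dom r A) w)
    = e2ennreal (max 0 (ereal (tcheb z w r) - min_tcheb z A w))"
proof (cases "A = {}")
  case True
  then show ?thesis
    by (simp add: shadow_def inf_tcheb_def Dom_def min_tcheb_def top_ereal_def e2ennreal_neg)
next
  case False
  define h where "h = (MIN a\<in>A. tcheb z w a)"
  have h: "min_tcheb z A w = ereal h"
    using False by (simp add: min_tcheb_def h_def)
  have "inf_tcheb z (Dom r A) w = ereal h"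
    using inf_tcheb_Dom[of A r w z] assms h by simp
  then have "shadow z r (Dom r A) w = {h..tcheb z w r}"
    by (auto simp: shadow_def)
  then have "hausdorff_measure 1 (shadow z r (Dom r A) w) = ennreal (tcheb z w r - h)"
    by (simp only: hausdorff_measure_1_atLeastAtMost)
  then show ?thesis
    by (simp add: h max_def e2ennreal_neg ennreal_neg)
qed

lemma shadow_mono:
  assumes "D \<subseteq> E"
  shows "shadow z r D w \<subseteq> shadow z r E w"
proof -
  have "inf_tcheb z E w \<le> inf_tcheb z D w"
    unfolding inf_tcheb_def using assms by (rule INF_superset_mono) simp
  then show ?thesis
    by (auto simp: shadow_def intro: order_trans)
qed

lemma TSM_mono:
  assumes "D \<subseteq> E"
  shows "TSM \<rho> z r D \<le> TSM \<rho> z r E"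
  unfolding TSM_def
  by (intro nn_integral_mono mult_right_mono hausdorff_measure_mono shadow_mono assms) simp

theorem theorem6p4:
  fixes r z :: "real ^ 'm" and \<rho> :: "real ^ 'm \<Rightarrow> real"
  assumes "\<rho> \<in> borel_measurable simplex_surface"
    and "\<And>w. w \<in> weight_simplex \<Longrightarrow> 0 \<le> \<rho> w"
  shows "(\<forall>A. finite A \<and> (\<forall>a\<in>A. \<forall>i. a $ i \<le> r $ i) \<longrightarrow>
            TSM \<rho> z r (Dom r A) = R2_improvement \<rho> z r A) \<and>
         (\<forall>A B. finite A \<and> finite B \<and> Dom r B \<subseteq> Dom r A \<longrightarrow>
            TSM \<rho> z r (Dom r A) \<ge> TSM \<rho> z r (Dom r B))"
proof (intro conjI allI impI)
  fix A :: "(real ^ 'm) set"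
  assume A: "finite A \<and> (\<forall>a\<in>A. \<forall>i. a $ i \<le> r $ i)"
  show "TSM \<rho> z r (Dom r A) = R2_improvement \<rho> z r A"
    unfolding TSM_def R2_improvement_def
  proof (rule nn_integral_cong)
    fix w :: "real ^ 'm"
    assume "w \<in> space simplex_surface"
    then have "0 \<le> w $ i" for i
      by (auto simp: simplex_surface_def space_restrict_space weight_simplex_def)
    then show "hausdorff_measure 1 (shadow z r (Dom r A) w) * ennreal (\<rho> w)
        = e2ennreal (max 0 (ereal (tcheb z w r) - min_tcheb z A w)) * ennreal (\<rho> w)"
      using A by (subst hausdorff_measure_shadow_Dom) auto
  qed
qed (auto intro: TSM_mono)

end
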